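(* There is an absolute constant $C>0$ such that for every integer $N\ge 2$ there is a red/blue edge-coloring of $K_N^{(3)}$ such that every tightly connected subgraph all of whose edges are red is tripartite, and every set of vertices all of whose triples are blue has size at most $C(\log N)^{3/2}$.
   Context: $K_N^{(3)}$ is the complete $3$-uniform hypergraph on $N$ vertices. A $3$-graph is tightly connected if for any two edges $e,f$ there is a sequence of edges $e=e_0,\dots,e_t=f$ with $e_{i-1}$ and $e_i$ sharing two vertices for each $i$. A $3$-graph is tripartite if its vertex set can be partitioned into three parts so that every edge has exactly one vertex in each part. *)

theory Defs
  imports Complex_Main "HOL-Library.Ramsey"
begin

text \<open>
  A \<open>3\<close>-graph is given by a vertex set \<open>V\<close> and an edge set \<open>E\<close>. The complete \<open>3\<close>-graph on \<open>V\<close>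
  has edge set \<open>nsets V 3\<close>.
\<close>

definition three_graph :: "'a set \<Rightarrow> 'a set set \<Rightarrow> bool" where
  "three_graph V E \<longleftrightarrow> E \<subseteq> nsets V 3"

definition subgraph :: "'a set \<Rightarrow> 'a set set \<Rightarrow> 'a set \<Rightarrow> 'a set set \<Rightarrow> bool" where
  "subgraph V' E' V E \<longleftrightarrow> three_graph V' E' \<and> V' \<subseteq> V \<and> E' \<subseteq> E"

definition tightly_connected :: "'a set set \<Rightarrow> bool" where
  "tightly_connected E \<longleftrightarrow>
     (\<forall>e\<in>E. \<forall>f\<in>E. \<exists>(p :: nat \<Rightarrow> 'a set) t.
        p 0 = e \<and> p t = f \<and> (\<forall>i\<le>t. p i \<in> E) \<and> (\<forall>i<t. card (p i \<inter> p (Suc i)) = 2))"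

text \<open>Parts may be empty, so that a \<open>3\<close>-graph without edges is tripartite.\<close>

definition tripartite :: "'a set \<Rightarrow> 'a set set \<Rightarrow> bool" where
  "tripartite V E \<longleftrightarrow>
     (\<exists>X Y Z. X \<union> Y \<union> Z = V \<and> X \<inter> Y = {} \<and> X \<inter> Z = {} \<and> Y \<inter> Z = {} \<and>
        (\<forall>e\<in>E. card (e \<inter> X) = 1 \<and> card (e \<inter> Y) = 1 \<and> card (e \<inter> Z) = 1))"

text \<open>
  An edge-coloring is a function on all sets of vertices; only its values on edges are ever used.
\<close>

datatype color = Red | Blue

end

theory Submission
  imports Defs "HOL-Probability.Product_PMF"
begin

text \<open>
  Let \<open>L = ln N\<close> and \<open>k \<approx> 400 L\<close>. Choose maps \<open>f\<^sub>c : V \<rightarrow> {0,1,2}\<close> for \<open>c < k\<close> such that every triple is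
  mapped injectively by at least \<open>k/108\<close> of them, and color the pairs of vertices uniformly at random
  with \<open>k\<close> colors. A triple is red iff its three pairs have a common color \<open>c\<close> and \<open>f\<^sub>c\<close> is injective
  on it. Consecutive edges of a tight walk share a pair, so a tightly connected red subgraph has a
  single color \<open>c\<close> and \<open>f\<^sub>c\<close> is its tripartition. A given set of \<open>n\<close> vertices spans on average
  \<open>\<Theta>(n\<^sup>3/k\<^sup>2)\<close> red triples, and a Janson-type inequality shows that it spans none with probability
  \<open>exp (-\<Omega>(n\<^sup>3/k\<^sup>2))\<close>; for \<open>n\<close> a large multiple of \<open>L\<^sup>3\<^sup>/\<^sup>2\<close> this beats the \<open>N\<^sup>n = exp (n L)\<close> choices of the set.
\<close>

section \<open>A Janson-type inequality derived from the Local Lemma\<close>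

context prob_space
begin

definition avoid :: "('i \<Rightarrow> 'a set) \<Rightarrow> 'i set \<Rightarrow> 'a set" where
  "avoid A J = space M - (\<Union>j\<in>J. A j)"

lemma avoid_in_events [measurable]:
  "finite J \<Longrightarrow> (\<And>j. j \<in> J \<Longrightarrow> A j \<in> events) \<Longrightarrow> avoid A J \<in> events"
  unfolding avoid_def by blast

lemma avoid_antimono: "J \<subseteq> K \<Longrightarrow> avoid A K \<subseteq> avoid A J"
  unfolding avoid_def by auto

text \<open>A union bound relative to \<open>B \<inter> avoid A J\<close>: whatever is lost in
  passing from \<open>J\<close> to \<open>J \<union> K\<close> lies in some \<open>A j\<close> with
  \<open>j \<in> K\<close>. It is used with \<open>B\<close> the whole space and with
  \<open>B = A i\<close>.\<close>

lemma prob_avoid_Un_ge: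
  assumes "finite J" "finite K" "\<And>j. j \<in> J \<union> K \<Longrightarrow> A j \<in> events" "B \<in> events"
  shows "prob (B \<inter> avoid A J) - (\<Sum>j\<in>K. prob (B \<inter> A j \<inter> avoid A J)) \<le> prob (B \<inter> avoid A (J \<union> K))"
proof -
  have ev: "avoid A J \<in> events" "avoid A (J \<union> K) \<in> events"
    using assms by (auto intro!: avoid_in_events)
  have "prob (B \<inter> avoid A J)
      \<le> prob ((B \<inter> avoid A (J \<union> K)) \<union> (\<Union>j\<in>K. B \<inter> A j \<inter> avoid A J))"
    using assms ev
    by (intro finite_measure_mono sets.Un sets.Int sets.finite_UN) (auto simp: avoid_def)
  also have "\<dots> \<le> prob (B \<inter> avoid A (J \<union> K)) + prob (\<Union>j\<in>K. B \<inter> A j \<inter> avoid A J)"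
    using assms ev by (intro measure_Un_le sets.Int sets.finite_UN) auto
  also have "prob (\<Union>j\<in>K. B \<inter> A j \<inter> avoid A J) \<le> (\<Sum>j\<in>K. prob (B \<inter> A j \<inter> avoid A J))"
    using assms ev by (intro finite_measure_subadditive_finite) auto
  finally show ?thesis by simp
qed

text \<open>
  Harris' inequality is unavailable because the red events are not monotone; the Local Lemma replaces
  it, using that each dependency neighborhood has small total probability.
\<close>

lemma prob_avoid_le_exp:
  fixes A :: "'i \<Rightarrow> 'a set" and nb :: "'i \<Rightarrow> 'i set"
  assumes fin: "finite I" and ev: "\<And>i. i \<in> I \<Longrightarrow> A i \<in> events"
    and nb: "\<And>i. i \<in> I \<Longrightarrow> nb i \<subseteq> I"
    and ind1: "\<And>i J. i \<in> I \<Longrightarrow> J \<subseteq> I - insert i (nb i) \<Longrightarrow>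
        prob (A i \<inter> avoid A J) = prob (A i) * prob (avoid A J)"
    and ind2: "\<And>i j J. i \<in> I \<Longrightarrow> j \<in> nb i \<Longrightarrow> J \<subseteq> I - (insert i (nb i) \<union> insert j (nb j)) \<Longrightarrow>
        prob (A i \<inter> A j \<inter> avoid A J) = prob (A i \<inter> A j) * prob (avoid A J)"
    and small: "\<And>i. i \<in> I \<Longrightarrow> prob (A i) + (\<Sum>j\<in>nb i. prob (A j)) \<le> 1/8"
    and corr: "\<And>i. i \<in> I \<Longrightarrow> (\<Sum>j\<in>nb i. prob (A i \<inter> A j)) \<le> prob (A i) / 4"
  shows "prob (avoid A I) \<le> exp (- (\<Sum>i\<in>I. prob (A i)) / 2)"
proof -
  have finI: "finite J" if "J \<subseteq> I" for J using that fin finite_subset by blast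
  have evJ: "avoid A J \<in> events" if "J \<subseteq> I" for J
    using that finI ev by (intro avoid_in_events) auto
  have mono: "prob (avoid A K) \<le> prob (avoid A J)" if "J \<subseteq> K" "K \<subseteq> I" for J K
    using that by (intro finite_measure_mono avoid_antimono evJ) auto
  \<comment> \<open>The union bound over \<open>K\<close> loses at most \<open>1/4 * 2\<close> of
    \<open>prob (avoid A J)\<close>.\<close>
  have halve: "prob (avoid A J) / 2 \<le> prob (avoid A (J \<union> K))"
    if JK: "J \<union> K \<subseteq> I" and K: "(\<Sum>j\<in>K. prob (A j)) \<le> 1/4"
      and le: "\<And>j. j \<in> K \<Longrightarrow> prob (A j \<inter> avoid A J) \<le> 2 * prob (A j) * prob (avoid A J)" for J K
  proof -
    have "prob (space M \<inter> avoid A J) - (\<Sum>j\<in>K. prob (space M \<inter> A j \<inter> avoid A J))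
        \<le> prob (space M \<inter> avoid A (J \<union> K))"
      using JK finI ev by (intro prob_avoid_Un_ge) auto
    moreover have "space M \<inter> A j = A j" if "j \<in> K" for j
      using sets.sets_into_space[OF ev[of j]] that JK by auto
    moreover have "space M \<inter> avoid A J = avoid A J" for J by (auto simp: avoid_def)
    ultimately have "prob (avoid A J) - (\<Sum>j\<in>K. prob (A j \<inter> avoid A J)) \<le> prob (avoid A (J \<union> K))"
      by simp
    moreover have "(\<Sum>j\<in>K. prob (A j \<inter> avoid A J)) \<le> (\<Sum>j\<in>K. 2 * prob (A j) * prob (avoid A J))"
      by (intro sum_mono le)
    moreover have "\<dots> = (\<Sum>j\<in>K. prob (A j)) * (2 * prob (avoid A J))"
      by (simp add: sum_distrib_left sum_distrib_right mult_ac)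
    moreover have "\<dots> \<le> 1/4 * (2 * prob (avoid A J))"
      by (intro mult_right_mono K) auto
    ultimately show ?thesis by linarith
  qed
  \<comment> \<open>The bound is half of what \<open>halve\<close> permits, because
    \<open>pair\<close> below restores the neighborhoods of two indices at once.\<close>
  have nb_sum: "(\<Sum>j\<in>K. prob (A j)) \<le> 1/8" if "i \<in> I" "K \<subseteq> insert i (nb i)" for i K
  proof -
    have f: "finite (nb i)" using nb[OF that(1)] finI by auto
    have "(\<Sum>j\<in>K. prob (A j)) \<le> (\<Sum>j\<in>insert i (nb i). prob (A j))"
      using that f by (intro sum_mono2) auto
    also have "\<dots> \<le> prob (A i) + (\<Sum>j\<in>nb i. prob (A j))"
      using f by (cases "i \<in> nb i") (auto simp: insert_absorb)
    finally show ?thesis using small[OF that(1)] by linarith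
  qed
  \<comment> \<open>Local Lemma induction: \<open>A i\<close> is independent of the non-neighbors
    \<open>?J\<close>. If \<open>?K\<close> is nonempty, then \<open>?J\<close> is smaller than
    \<open>J\<close>, so the induction hypothesis bounds each \<open>A j\<close> with
    \<open>j \<in> ?K\<close>, and by \<open>halve\<close> restoring \<open>?K\<close> costs a
    factor 2.\<close>
  have lll: "prob (A i \<inter> avoid A J) \<le> 2 * prob (A i) * prob (avoid A J)"
    if "i \<in> I" "J \<subseteq> I - {i}" for i J
    using that
  proof (induction "card J" arbitrary: i J rule: less_induct)
    case less
    let ?K = "J \<inter> nb i" and ?J = "J - nb i"
    have "prob (avoid A ?J) / 2 \<le> prob (avoid A (?J \<union> ?K))"
    proof (rule halve)
      fix j assume j: "j \<in> ?K"
      have "card ?J < card J"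
        using j less.prems finI by (intro psubset_card_mono) auto
      then show "prob (A j \<inter> avoid A ?J) \<le> 2 * prob (A j) * prob (avoid A ?J)"
        using j less.prems by (intro less.hyps) auto
    next
      show "(\<Sum>j\<in>?K. prob (A j)) \<le> 1/4"
        using nb_sum[of i ?K] less.prems(1) by force
    qed (use less.prems in auto)
    moreover have "?J \<union> ?K = J" by auto
    moreover have "prob (A i \<inter> avoid A J) \<le> prob (A i \<inter> avoid A ?J)"
      using less.prems by (intro finite_measure_mono Int_mono avoid_antimono sets.Int ev evJ) auto
    moreover have "prob (A i \<inter> avoid A ?J) = prob (A i) * prob (avoid A ?J)"
      using less.prems by (intro ind1) auto
    moreover have "prob (A i) * prob (avoid A ?J) \<le> prob (A i) * (2 * prob (avoid A J))"
      using calculation by (intro mult_left_mono) auto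
    ultimately show ?case by simp
  qed
  \<comment> \<open>The converse estimate: independence of \<open>?J\<close> gives the full
    \<open>prob (A i)\<close>, and the pairs with neighbors subtract at most
    \<open>prob (A i) / 4 * 2\<close>, by \<open>corr\<close> and \<open>pair\<close>.\<close>
  have lower: "prob (A i) / 2 * prob (avoid A J) \<le> prob (A i \<inter> avoid A J)"
    if i: "i \<in> I" and J: "J \<subseteq> I - {i}" for i J
  proof -
    let ?K = "J \<inter> nb i" and ?J = "J - nb i"
    \<comment> \<open>Dropping the neighbors of \<open>j\<close> as well makes
      \<open>A i \<inter> A j\<close> independent of the rest; \<open>halve\<close> then returns to
      all of \<open>J\<close>.\<close>
    have pair: "prob (A i \<inter> A j \<inter> avoid A ?J) \<le> prob (A i \<inter> A j) * (2 * prob (avoid A J))"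
      if j: "j \<in> ?K" for j
    proof -
      let ?J' = "J - (nb i \<union> insert j (nb j))" and ?K' = "J \<inter> (nb i \<union> insert j (nb j))"
      have jI: "j \<in> I" "j \<noteq> i" using j J by auto
      have "prob (A i \<inter> A j \<inter> avoid A ?J) \<le> prob (A i \<inter> A j \<inter> avoid A ?J')"
        using J i jI by (intro finite_measure_mono Int_mono avoid_antimono sets.Int ev evJ) auto
      also have "\<dots> = prob (A i \<inter> A j) * prob (avoid A ?J')"
        using J i j by (intro ind2) auto
      finally have 1: "prob (A i \<inter> A j \<inter> avoid A ?J) \<le> \<dots>" .
      have "prob (avoid A ?J') / 2 \<le> prob (avoid A (?J' \<union> ?K'))"
      proof (rule halve)
        have "(\<Sum>j\<in>?K'. prob (A j)) \<le> (\<Sum>j\<in>J \<inter> nb i. prob (A j)) + (\<Sum>j\<in>J \<inter> insert j (nb j). prob (A j))"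
          by (subst Int_Un_distrib, subst sum_Un) (use J finI in \<open>auto intro!: sum_nonneg\<close>)
        also have "\<dots> \<le> 1/8 + 1/8"
          using i jI by (intro add_mono nb_sum[of i] nb_sum[of j]) auto
        finally show "(\<Sum>j\<in>?K'. prob (A j)) \<le> 1/4" by simp
      qed (use J nb i jI in \<open>auto intro!: lll\<close>)
      moreover have "?J' \<union> ?K' = J" by auto
      ultimately have "prob (avoid A ?J') \<le> 2 * prob (avoid A J)" by simp
      with 1 show ?thesis by (meson mult_left_mono measure_nonneg order_trans)
    qed
    have "prob (A i \<inter> avoid A ?J) - (\<Sum>j\<in>?K. prob (A i \<inter> A j \<inter> avoid A ?J)) \<le> prob (A i \<inter> avoid A (?J \<union> ?K))"
      using J i ev finI[of ?J] finI[of ?K] by (intro prob_avoid_Un_ge) blast+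
    moreover have "?J \<union> ?K = J" by auto
    moreover have "prob (A i \<inter> avoid A ?J) = prob (A i) * prob (avoid A ?J)"
      using J i by (intro ind1) auto
    moreover have "prob (A i) * prob (avoid A J) \<le> prob (A i) * prob (avoid A ?J)"
      using J by (intro mult_left_mono mono) auto
    moreover have "(\<Sum>j\<in>?K. prob (A i \<inter> A j \<inter> avoid A ?J)) \<le> (\<Sum>j\<in>?K. prob (A i \<inter> A j)) * (2 * prob (avoid A J))"
      by (subst sum_distrib_right) (intro sum_mono pair)
    moreover have "\<dots> \<le> prob (A i) / 4 * (2 * prob (avoid A J))"
    proof (rule mult_right_mono)
      have "(\<Sum>j\<in>?K. prob (A i \<inter> A j)) \<le> (\<Sum>j\<in>nb i. prob (A i \<inter> A j))"
        using nb[OF i] finI by (intro sum_mono2) auto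
      then show "(\<Sum>j\<in>?K. prob (A i \<inter> A j)) \<le> prob (A i) / 4" using corr[OF i] by linarith
    qed simp
    ultimately show ?thesis by simp
  qed
  \<comment> \<open>By \<open>lower\<close>, each new index \<open>i\<close> multiplies the
    probability by at most \<open>1 - prob (A i) / 2 \<le> exp (- (prob (A i) / 2))\<close>.\<close>
  have "prob (avoid A J) \<le> exp (- (\<Sum>i\<in>J. prob (A i)) / 2)" if "J \<subseteq> I" for J
    using finI[OF that] that
  proof (induction J rule: finite_induct)
    case empty
    then show ?case by simp
  next
    case (insert i J)
    have "avoid A (insert i J) = avoid A J - A i \<inter> avoid A J" by (auto simp: avoid_def)
    then have "prob (avoid A (insert i J)) = prob (avoid A J) - prob (A i \<inter> avoid A J)"
      using insert.prems evJ[of J] ev[of i] by (simp add: finite_measure_Diff)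
    also have "\<dots> \<le> (1 - prob (A i) / 2) * prob (avoid A J)"
      using lower[of i J] insert by (auto simp: algebra_simps)
    also have "\<dots> \<le> exp (- (prob (A i) / 2)) * exp (- (\<Sum>i\<in>J. prob (A i)) / 2)"
      using insert exp_ge_add_one_self[of "- (prob (A i) / 2)"]
      by (intro mult_mono) auto
    also have "\<dots> = exp (- (\<Sum>i\<in>insert i J. prob (A i)) / 2)"
      using insert by (simp add: exp_add[symmetric] field_simps)
    finally show ?case .
  qed
  then show ?thesis by simp
qed

end

section \<open>Independence and monochromatic sets in a random coloring\<close>

text \<open>The product measure on \<open>E\<close> splits into those on \<open>D\<close> and
  \<open>E - D\<close>; \<open>P\<close> is decided by the first factor and \<open>Q\<close> by the
  second.\<close>

lemma prob_Pi_pmf_indep: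
  assumes fin: "finite E" and D: "D \<subseteq> E"
    and P: "\<And>f g. (\<And>x. x \<in> D \<Longrightarrow> f x = g x) \<Longrightarrow> f \<in> P \<longleftrightarrow> g \<in> P"
    and Q: "\<And>f g. (\<And>x. x \<in> E - D \<Longrightarrow> f x = g x) \<Longrightarrow> f \<in> Q \<longleftrightarrow> g \<in> Q"
  shows "measure_pmf.prob (Pi_pmf E d p) (P \<inter> Q)
    = measure_pmf.prob (Pi_pmf E d p) P * measure_pmf.prob (Pi_pmf E d p) Q"
proof -
  let ?M1 = "Pi_pmf D d p" and ?M2 = "Pi_pmf (E - D) d p"
  let ?h = "\<lambda>(f, g) x. if x \<in> D then f x else g x"
  have E: "Pi_pmf E d p = map_pmf ?h (pair_pmf ?M1 ?M2)"
    using Pi_pmf_union[of D "E - D" d p] fin D finite_subset[OF D fin] by (auto simp: Un_absorb1)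
  \<comment> \<open>The product rule is applied to countable sets, so \<open>A\<close> and
    \<open>B\<close> are first cut down to the supports.\<close>
  have pr: "measure_pmf.prob (pair_pmf ?M1 ?M2) (A \<times> B) = measure_pmf.prob ?M1 A * measure_pmf.prob ?M2 B" for A B
  proof -
    have "measure_pmf.prob (pair_pmf ?M1 ?M2) (A \<times> B)
        = measure_pmf.prob (pair_pmf ?M1 ?M2) ((A \<inter> set_pmf ?M1) \<times> (B \<inter> set_pmf ?M2))"
      by (subst measure_Int_set_pmf[symmetric]) (auto intro!: arg_cong2[where f = measure])
    also have "\<dots> = measure_pmf.prob ?M1 (A \<inter> set_pmf ?M1) * measure_pmf.prob ?M2 (B \<inter> set_pmf ?M2)"
      by (intro measure_pmf_prob_product) (auto intro: countable_subset[OF _ countable_set_pmf])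
    finally show ?thesis by (simp add: measure_Int_set_pmf)
  qed
  have hP: "?h (f, g) \<in> P \<longleftrightarrow> f \<in> P" for f g by (rule P) auto
  have hQ: "?h (f, g) \<in> Q \<longleftrightarrow> g \<in> Q" for f g by (rule Q) auto
  have 1: "?h -` (P \<inter> Q) = P \<times> Q" "?h -` P = P \<times> UNIV" "?h -` Q = UNIV \<times> Q"
    using hP hQ by auto
  show ?thesis unfolding E measure_map_pmf 1 pr by simp
qed

text \<open>As \<open>D\<close> is nonempty, the events for different \<open>c\<close> are disjoint,
  and each has probability \<open>(1 / k) ^ card D\<close>.\<close>

lemma prob_Pi_pmf_constant_on:
  fixes k :: nat
  assumes fin: "finite E" and D: "D \<subseteq> E" "D \<noteq> {}" and R: "R \<subseteq> {..<k}"
  shows "measure_pmf.prob (Pi_pmf E d (\<lambda>_. pmf_of_set {..<k})) {g. \<exists>c\<in>R. \<forall>e\<in>D. g e = c}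
    = card R / k ^ card D"
proof (cases "k = 0")
  case True
  with R D fin show ?thesis by (simp add: finite_subset)
next
  case False
  let ?M = "Pi_pmf E d (\<lambda>_. pmf_of_set {..<k})"
  have "measure_pmf.prob ?M {g. \<exists>c\<in>R. \<forall>e\<in>D. g e = c} = measure_pmf.prob ?M (\<Union>c\<in>R. {g. \<forall>e\<in>D. g e = c})"
    by (rule arg_cong2[where f = measure]) auto
  also have "\<dots> = (\<Sum>c\<in>R. measure_pmf.prob ?M {g. \<forall>e\<in>D. g e = c})"
    using D finite_subset[OF R]
    by (intro measure_pmf.finite_measure_finite_Union) (auto simp: disjoint_family_on_def)
  also have "\<dots> = (\<Sum>c\<in>R. (1 / k) ^ card D)"
  proof (rule sum.cong[OF refl])
    fix c assume c: "c \<in> R"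
    then have "c < k" using R by auto
    have "measure_pmf.prob ?M {g. \<forall>e\<in>D. g e = c}
        = measure_pmf.prob ?M (Pi E (\<lambda>e. if e \<in> D then {c} else UNIV))"
      using D by (intro arg_cong2[where f = measure]) (auto simp: Pi_def subset_iff split: if_splits)
    also have "\<dots> = (\<Prod>e\<in>E. if e \<in> D then 1 / k else 1)"
      using fin \<open>c < k\<close>
      by (subst measure_Pi_pmf_Pi) (auto intro!: prod.cong simp: measure_pmf_single pmf_of_set lessThan_empty_iff)
    also have "\<dots> = (1 / k) ^ card D"
      using fin D by (subst prod.inter_restrict[symmetric]) (auto simp: Int_absorb1)
    finally show "measure_pmf.prob ?M {g. \<forall>e\<in>D. g e = c} = (1 / k) ^ card D" .
  qed
  finally show ?thesis by (simp add: power_one_over divide_simps)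
qed

section \<open>Counting subsets, and maps to three values that are injective on many triples\<close>

lemma card_nsets: "finite A \<Longrightarrow> card (nsets A r) = card A choose r"
proof -
  assume A: "finite A"
  then have "nsets A r = {B. B \<subseteq> A \<and> card B = r}" by (auto simp: nsets_def dest: finite_subset)
  with A show ?thesis by (simp add: n_subsets)
qed

text \<open>Averaging over all maps from \<open>V\<close> to three values: at least 1/27 of them are
  injective on any given triple, so some map captures 1/27 of the weight.\<close>

lemma ex_weighted_max_3cut:
  fixes w :: "'a set \<Rightarrow> real"
  assumes fin: "finite V" and w: "\<And>T. w T \<ge> 0"
  shows "\<exists>g. (\<forall>v. g v < (3::nat)) \<and>
    (\<Sum>T\<in>nsets V 3. w T) \<le> 27 * (\<Sum>T | T \<in> nsets V 3 \<and> inj_on g T. w T)"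
proof (rule ccontr)
  assume neg: "\<not> ?thesis"
  define \<Omega> where "\<Omega> = V \<rightarrow>\<^sub>E {..<3::nat}"
  have \<Omega>: "finite \<Omega>" "card \<Omega> > 0"
    using fin by (auto simp: \<Omega>_def card_PiE intro!: finite_PiE)
  have finT: "finite (nsets V 3)" using fin by (rule finite_imp_finite_nsets)
  have "27 * (\<Sum>T | T \<in> nsets V 3 \<and> inj_on g T. w T) < (\<Sum>T\<in>nsets V 3. w T)" if "g \<in> \<Omega>" for g
  proof -
    \<comment> \<open>Members of \<open>\<Omega>\<close> are undefined outside \<open>V\<close>; the
      value 0 there makes the bound by 3 hold everywhere.\<close>
    let ?g = "\<lambda>v. if v \<in> V then g v else 0"
    have "?g v < 3" for v using that by (auto simp: \<Omega>_def PiE_def Pi_def)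
    then have "27 * (\<Sum>T | T \<in> nsets V 3 \<and> inj_on ?g T. w T) < (\<Sum>T\<in>nsets V 3. w T)"
      using spec[OF neg[unfolded not_ex], of ?g] by (simp only: not_le simp_thms)
    moreover have "inj_on ?g T \<longleftrightarrow> inj_on g T" if "T \<in> nsets V 3" for T
      using that by (intro inj_on_cong) (auto simp: nsets_def)
    ultimately show ?thesis by (simp cong: conj_cong)
  qed
  then have "(\<Sum>g\<in>\<Omega>. 27 * (\<Sum>T | T \<in> nsets V 3 \<and> inj_on g T. w T)) < (\<Sum>g\<in>\<Omega>. \<Sum>T\<in>nsets V 3. w T)"
    using \<Omega> by (intro sum_strict_mono) auto
  moreover have "(\<Sum>g\<in>\<Omega>. \<Sum>T\<in>nsets V 3. w T) \<le> (\<Sum>g\<in>\<Omega>. 27 * (\<Sum>T | T \<in> nsets V 3 \<and> inj_on g T. w T))"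
  proof -
    \<comment> \<open>Every map arises from one that is injective on \<open>T\<close> by overwriting
      its three values on \<open>T\<close>, which can be done in 27 ways.\<close>
    have count: "card \<Omega> \<le> 27 * card {g \<in> \<Omega>. inj_on g T}" if "T \<in> nsets V 3" for T
    proof -
      from that obtain x y z where T: "T = {x, y, z}" "x \<in> V" "y \<in> V" "z \<in> V" "x \<noteq> y" "x \<noteq> z" "y \<noteq> z"
        unfolding nsets_3_eq by blast
      let ?S = "{g \<in> \<Omega>. inj_on g T} \<times> {..<3::nat} \<times> {..<3::nat} \<times> {..<3::nat}"
      let ?\<phi> = "\<lambda>(h, a, b, c). h(x := a, y := b, z := c)"
      have "\<Omega> \<subseteq> ?\<phi> ` ?S"
      proof
        fix g assume g: "g \<in> \<Omega>"
        let ?h = "g(x := 0, y := 1, z := 2)"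
        have "g = ?\<phi> (?h, g x, g y, g z)" using T by (auto simp: fun_eq_iff)
        moreover have "?h \<in> \<Omega>"
        proof -
          have "?h \<in> insert z (insert y (insert x V)) \<rightarrow>\<^sub>E {..<3}"
            using g unfolding \<Omega>_def by (intro PiE_fun_upd) auto
          then show ?thesis using T by (simp add: \<Omega>_def insert_absorb)
        qed
        moreover have "inj_on ?h T" using T by (auto simp: inj_on_def)
        moreover have "g x < 3" "g y < 3" "g z < 3"
          using g T PiE_mem[of g V "\<lambda>_. {..<3}"] by (auto simp: \<Omega>_def)
        ultimately have "g = ?\<phi> (?h, g x, g y, g z)" "(?h, g x, g y, g z) \<in> ?S" by blast+
        then show "g \<in> ?\<phi> ` ?S" by (rule image_eqI)
      qed
      moreover have "finite ?S" using \<Omega> by auto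
      ultimately have "card \<Omega> \<le> card ?S" by (rule surj_card_le[rotated])
      then show ?thesis by (simp add: card_cartesian_product)
    qed
    have "(\<Sum>g\<in>\<Omega>. \<Sum>T\<in>nsets V 3. w T) = (\<Sum>T\<in>nsets V 3. card \<Omega> * w T)"
      by (subst sum.swap) simp
    also have "\<dots> \<le> (\<Sum>T\<in>nsets V 3. real (27 * card {g \<in> \<Omega>. inj_on g T}) * w T)"
      using count w by (intro sum_mono mult_right_mono) (simp_all only: of_nat_le_iff)
    also have "\<dots> = (\<Sum>T\<in>nsets V 3. \<Sum>g | g \<in> \<Omega> \<and> inj_on g T. 27 * w T)"
      by (simp add: mult_ac)
    also have "\<dots> = (\<Sum>g\<in>\<Omega>. \<Sum>T | T \<in> nsets V 3 \<and> inj_on g T. 27 * w T)"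
      using \<Omega> finT by (intro sum.swap_restrict)
    finally show ?thesis by (simp add: sum_distrib_left)
  qed
  ultimately show False by linarith
qed

text \<open>
  A new coloring that is injective on at least \<open>1/27\<close> of the weight \<open>(1/2)\<^sup>r\<close> of the triples lowers
  the total weight by the factor \<open>1 - 1/54\<close>.
\<close>

lemma ex_3colorings_small_potential:
  assumes fin: "finite V"
  shows "\<exists>f :: nat \<Rightarrow> 'a \<Rightarrow> nat. (\<forall>c v. f c v < 3) \<and>
    (\<Sum>T\<in>nsets V 3. (1/2) ^ card {c. c < j \<and> inj_on (f c) T}) \<le> (53/54) ^ j * real (card (nsets V 3))"
proof (induction j)
  case 0
  show ?case by (rule exI[of _ "\<lambda>_ _. 0"]) simp
next
  case (Suc j)
  then obtain f :: "nat \<Rightarrow> 'a \<Rightarrow> nat" where f: "\<And>c v. f c v < 3"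
    "(\<Sum>T\<in>nsets V 3. (1/2) ^ card {c. c < j \<and> inj_on (f c) T}) \<le> (53/54) ^ j * real (card (nsets V 3))"
    by blast
  define w :: "'a set \<Rightarrow> real" where "w T = (1/2) ^ card {c. c < j \<and> inj_on (f c) T}" for T
  obtain g :: "'a \<Rightarrow> nat" where g: "\<And>v. g v < 3"
    "(\<Sum>T\<in>nsets V 3. w T) \<le> 27 * (\<Sum>T | T \<in> nsets V 3 \<and> inj_on g T. w T)"
    using ex_weighted_max_3cut[OF fin, of w] by (force simp: w_def)
  let ?f = "f(j := g)"
  have eq: "(1/2) ^ card {c. c < Suc j \<and> inj_on (?f c) T} = w T - (if inj_on g T then w T / 2 else 0)" for T
  proof -
    have "{c. c < Suc j \<and> inj_on (?f c) T}
        = (if inj_on g T then insert j {c. c < j \<and> inj_on (f c) T} else {c. c < j \<and> inj_on (f c) T})"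
      by (auto simp: less_Suc_eq)
    then show ?thesis by (simp add: w_def)
  qed
  have "(\<Sum>T\<in>nsets V 3. (1/2) ^ card {c. c < Suc j \<and> inj_on (?f c) T})
      = (\<Sum>T\<in>nsets V 3. w T) - (\<Sum>T | T \<in> nsets V 3 \<and> inj_on g T. w T) / 2"
    unfolding eq sum_subtractf sum_divide_distrib
    by (subst sum.inter_filter) (use fin in \<open>auto intro: finite_imp_finite_nsets\<close>)
  also have "\<dots> \<le> 53/54 * (\<Sum>T\<in>nsets V 3. w T)" using g by linarith
  also have "\<dots> \<le> (53/54) ^ Suc j * real (card (nsets V 3))" using f by (simp add: w_def)
  finally show ?case using f g by (intro exI[of _ ?f]) auto
qed

text \<open>A triple on which \<open>r\<close> of the maps are injective contributes
  \<open>(1/2) ^ r\<close> to the potential. Comparing exponents, with at most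
  \<open>card V ^ 3\<close> triples, gives \<open>r \<ge> k / 54 - 3 * ln (card V)\<close>. As
  \<open>324 = 3 * 108\<close>, the subtracted term is below \<open>k / 108\<close>.\<close>

lemma ex_3colorings_injective_on_triples:
  fixes V :: "'a set"
  assumes fin: "finite V" and k: "324 * ln (card V) < real k"
  shows "\<exists>f :: nat \<Rightarrow> 'a \<Rightarrow> nat. (\<forall>c v. f c v < 3) \<and>
    (\<forall>T\<in>nsets V 3. real k \<le> 108 * card {c. c < k \<and> inj_on (f c) T})"
proof -
  obtain f :: "nat \<Rightarrow> 'a \<Rightarrow> nat" where f: "\<And>c v. f c v < 3"
    "(\<Sum>T\<in>nsets V 3. (1/2) ^ card {c. c < k \<and> inj_on (f c) T}) \<le> (53/54) ^ k * real (card (nsets V 3))"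
    using ex_3colorings_small_potential[OF fin] by blast
  have "real k \<le> 108 * card {c. c < k \<and> inj_on (f c) T}" if T: "T \<in> nsets V 3" for T
  proof -
    let ?r = "card {c. c < k \<and> inj_on (f c) T}"
    have V: "card V > 0" "3 \<le> card V"
      using T fin card_mono[of V T] by (auto simp: nsets_def)
    have "exp (- real ?r) \<le> (1/2) ^ ?r"
    proof -
      have "exp (- 1) \<le> (1/2 :: real)"
        using exp_ge_add_one_self[of 1] by (simp add: exp_minus field_simps)
      then have "exp (- 1) ^ ?r \<le> (1/2 :: real) ^ ?r" by (intro power_mono) auto
      then show ?thesis by (simp flip: exp_of_nat_mult)
    qed
    also have "\<dots> \<le> (\<Sum>T\<in>nsets V 3. (1/2) ^ card {c. c < k \<and> inj_on (f c) T})"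
      using T fin by (intro member_le_sum) (auto intro: finite_imp_finite_nsets)
    also note f(2)
    also have "(53/54) ^ k * real (card (nsets V 3)) \<le> exp (- real k / 54) * exp (3 * ln (card V))"
    proof (rule mult_mono)
      have "(53/54 :: real) ^ k \<le> exp (- 1/54) ^ k"
        using exp_ge_add_one_self[of "- 1/54"] by (intro power_mono) auto
      then show "(53/54 :: real) ^ k \<le> exp (- real k / 54)" by (simp flip: exp_of_nat_mult)
      have "real (card (nsets V 3)) \<le> real (card V ^ 3)"
        using V fin by (simp only: card_nsets of_nat_le_iff binomial_le_pow)
      then show "real (card (nsets V 3)) \<le> exp (3 * ln (card V))"
        using V exp_of_nat_mult[of 3 "ln (real (card V))"] by simp
    qed auto
    finally have "exp (- real ?r) \<le> exp (- real k / 54 + 3 * ln (card V))"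
      by (simp only: exp_add)
    then have "- real ?r \<le> - real k / 54 + 3 * ln (card V)" by (simp only: exp_le_cancel_iff)
    then show ?thesis using k by simp
  qed
  with f show ?thesis by blast
qed

section \<open>Tightly connected red subgraphs are tripartite\<close>

lemma tightly_connected_mono_tripartite:
  fixes \<kappa> :: "'a set \<Rightarrow> 'c" and f :: "'c \<Rightarrow> 'a \<Rightarrow> nat"
  assumes E: "three_graph V E" "tightly_connected E"
    and f: "\<And>c v. f c v < 3"
    and red: "\<And>e. e \<in> E \<Longrightarrow> \<exists>c. inj_on (f c) e \<and> (\<forall>d\<in>nsets e 2. \<kappa> d = c)"
  shows "tripartite V E"
proof (cases "E = {}")
  case True
  then show ?thesis unfolding tripartite_def by (intro exI[of _ V] exI[of _ "{}"]) auto
next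
  case False
  then obtain e0 where e0: "e0 \<in> E" by blast
  then obtain c where c: "inj_on (f c) e0" "\<forall>d\<in>nsets e0 2. \<kappa> d = c" using red by blast
  have inj: "inj_on (f c) e" if e: "e \<in> E" for e
  proof -
    obtain p :: "nat \<Rightarrow> 'a set" and t where p: "p 0 = e0" "p t = e" "\<And>i. i \<le> t \<Longrightarrow> p i \<in> E"
      "\<And>i. i < t \<Longrightarrow> card (p i \<inter> p (Suc i)) = 2"
      using E(2)[unfolded tightly_connected_def, rule_format, OF e0 e] by blast
    \<comment> \<open>The invariant carries the pair color too: the pair shared with the next edge
      then forces that edge to use the same \<open>c\<close>.\<close>
    have "i \<le> t \<Longrightarrow> inj_on (f c) (p i) \<and> (\<forall>d\<in>nsets (p i) 2. \<kappa> d = c)" for i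
    proof (induction i)
      case 0
      then show ?case using p c by simp
    next
      case (Suc i)
      obtain c' where c': "inj_on (f c') (p (Suc i))" "\<forall>d\<in>nsets (p (Suc i)) 2. \<kappa> d = c'"
        using red p(3) Suc.prems by blast
      have d: "card (p i \<inter> p (Suc i)) = 2" using p(4) Suc.prems by simp
      then have "finite (p i \<inter> p (Suc i))" by (metis card.infinite zero_neq_numeral)
      then have "p i \<inter> p (Suc i) \<in> nsets (p i) 2" "p i \<inter> p (Suc i) \<in> nsets (p (Suc i)) 2"
        using d by (auto simp: nsets_def)
      then have "c' = c" using c' Suc by auto
      then show ?case using c' by simp
    qed
    then show ?thesis using p(2) by auto
  qed
  let ?X = "\<lambda>i. {v \<in> V. f c v = i}"
  have "card (e \<inter> ?X i) = 1" if e: "e \<in> E" and i: "i < 3" for e i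
  proof -
    have eV: "e \<subseteq> V" "card e = 3" "finite e" using e E(1) by (auto simp: three_graph_def nsets_def)
    \<comment> \<open>An injective map from three vertices to three values is onto, so the edge
      meets every class, and meets it once.\<close>
    have "f c ` e = {..<3}"
      using f eV inj[OF e] by (intro card_subset_eq) (auto simp: card_image)
    then have "i \<in> f c ` e" using i by simp
    then obtain v where v: "v \<in> e" "f c v = i" by auto
    then have "e \<inter> ?X i = {v}" using eV inj[OF e] by (auto simp: inj_on_def)
    then show ?thesis by simp
  qed
  moreover have "?X 0 \<union> ?X 1 \<union> ?X 2 = V"
  proof -
    have "f c v = 0 \<or> f c v = 1 \<or> f c v = 2" for v using f[of c v] by linarith
    then show ?thesis by auto
  qed
  ultimately show ?thesis unfolding tripartite_def
    by (intro exI[of _ "?X 0"] exI[of _ "?X 1"] exI[of _ "?X 2"]) auto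
qed

section \<open>The probability that a vertex set spans no red triple\<close>

text \<open>The Janson-type bound applied to the events that a triple is red, with triples adjacent
  when they share a pair. Each event has probability between \<open>1 / (m * k^2)\<close> and
  \<open>1 / k^2\<close>, and each triple has at most \<open>3 * card S\<close> neighbors, so
  \<open>32 * card S \<le> k^2\<close> supplies the smallness conditions.\<close>

lemma prob_no_red_triple_le:
  fixes S :: "'a set" and k :: nat and R :: "'a set \<Rightarrow> nat set" and m :: real
  assumes V: "finite V" "S \<subseteq> V" and R: "\<And>T. R T \<subseteq> {..<k}"
    and Rk: "\<And>T. T \<in> nsets S 3 \<Longrightarrow> k \<le> m * card (R T)"
    and m: "m > 0" and k: "k > 0" and S: "32 * card S \<le> k ^ 2"
  shows "measure_pmf.prob (Pi_pmf (nsets V 2) 0 (\<lambda>_. pmf_of_set {..<k}))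
      {\<kappa>. \<forall>T\<in>nsets S 3. \<not> (\<exists>c\<in>R T. \<forall>d\<in>nsets T 2. \<kappa> d = c)}
    \<le> exp (- (real (card S choose 3) / (2 * m * k ^ 2)))"
proof -
  define M where "M = Pi_pmf (nsets V 2) 0 (\<lambda>_. pmf_of_set {..<k})"
  define A :: "'a set \<Rightarrow> ('a set \<Rightarrow> nat) set"
    where "A T = {\<kappa>. \<exists>c\<in>R T. \<forall>d\<in>nsets T 2. \<kappa> d = c}" for T
  define I where "I = nsets S 3"
  define nb where "nb T = {T' \<in> I - {T}. nsets T 2 \<inter> nsets T' 2 \<noteq> {}}" for T
  have finS: "finite S" using V finite_subset by blast
  have finI: "finite I" and finE: "finite (nsets V 2)"
    using finS V by (auto simp: I_def intro: finite_imp_finite_nsets)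
  have T: "T \<subseteq> S" "finite T" "card T = 3" "nsets T 2 \<subseteq> nsets V 2" "card (nsets T 2) = 3"
    "finite (nsets T 2)" "nsets T 2 \<noteq> {}" if "T \<in> I" for T
  proof -
    show 1: "T \<subseteq> S" "finite T" "card T = 3" using that by (auto simp: I_def nsets_def)
    then show "nsets T 2 \<subseteq> nsets V 2" using V by (intro nsets_mono) auto
    show "finite (nsets T 2)" using 1 by (simp add: finite_imp_finite_nsets)
    show c: "card (nsets T 2) = 3" using 1 by (simp add: card_nsets numeral_eq_Suc)
    then show "nsets T 2 \<noteq> {}" by (metis card.empty zero_neq_numeral)
  qed
  have avoid: "measure_pmf.avoid M A J = {\<kappa>. \<forall>T\<in>J. \<kappa> \<notin> A T}" for J
    by (auto simp: measure_pmf.avoid_def)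
  have A_cong: "\<kappa> \<in> A T \<longleftrightarrow> \<kappa>' \<in> A T" if "\<And>d. d \<in> nsets T 2 \<Longrightarrow> \<kappa> d = \<kappa>' d" for \<kappa> \<kappa>' T
    using that by (auto simp: A_def)
  \<comment> \<open>\<open>B\<close> looks only at the pairs in \<open>D\<close>, whereas the
    triples in \<open>J\<close> contain no pair of \<open>D\<close>.\<close>
  have indep: "measure_pmf.prob M (B \<inter> measure_pmf.avoid M A J)
      = measure_pmf.prob M B * measure_pmf.prob M (measure_pmf.avoid M A J)"
    if D: "D \<subseteq> nsets V 2" and J: "J \<subseteq> I" "\<And>T. T \<in> J \<Longrightarrow> nsets T 2 \<inter> D = {}"
      and B: "\<And>\<kappa> \<kappa>'. (\<And>d. d \<in> D \<Longrightarrow> \<kappa> d = \<kappa>' d) \<Longrightarrow> \<kappa> \<in> B \<longleftrightarrow> \<kappa>' \<in> B" for B D J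
    unfolding M_def
  proof (rule prob_Pi_pmf_indep[OF finE D B])
    fix \<kappa> \<kappa>' :: "'a set \<Rightarrow> nat"
    assume eq: "\<And>d. d \<in> nsets V 2 - D \<Longrightarrow> \<kappa> d = \<kappa>' d"
    have "\<kappa> \<in> A T \<longleftrightarrow> \<kappa>' \<in> A T" if "T \<in> J" for T
    proof (rule A_cong)
      fix d assume "d \<in> nsets T 2"
      then show "\<kappa> d = \<kappa>' d" using J that T(4)[of T] by (intro eq) blast
    qed
    then show "\<kappa> \<in> measure_pmf.avoid (Pi_pmf (nsets V 2) 0 (\<lambda>_. pmf_of_set {..<k})) A J \<longleftrightarrow>
        \<kappa>' \<in> measure_pmf.avoid (Pi_pmf (nsets V 2) 0 (\<lambda>_. pmf_of_set {..<k})) A J"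
      unfolding avoid[unfolded M_def] by simp
  qed
  have pA: "measure_pmf.prob M (A T) = card (R T) / k ^ 3" if "T \<in> I" for T
    using prob_Pi_pmf_constant_on[OF finE T(4)[OF that] T(7)[OF that] R, of 0 T] T(5)[OF that]
    by (simp add: M_def A_def)
  have RT: "real (card (R T)) \<le> k" for T
    using card_mono[OF _ R[of T]] by simp
  have pA_le: "measure_pmf.prob M (A T) \<le> 1 / k ^ 2" if "T \<in> I" for T
    using RT[of T] k by (simp add: pA[OF that] divide_simps power2_eq_square power3_eq_cube)
  \<comment> \<open>Distinct triples share at most one pair, so together they contain at least five.
    The shared pair forces a common color on all of them, which has probability at most
    \<open>card (R T) / k^5\<close>.\<close>
  have pAA: "measure_pmf.prob M (A T \<inter> A T') \<le> measure_pmf.prob M (A T) / k ^ 2"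
    if TI: "T \<in> I" and T': "T' \<in> nb T" for T T'
  proof -
    let ?D = "nsets T 2 \<union> nsets T' 2"
    have T'I: "T' \<in> I" "T' \<noteq> T" "nsets T 2 \<inter> nsets T' 2 \<noteq> {}" using T' by (auto simp: nb_def)
    note TT = T[OF TI] T[OF T'I(1)]
    \<comment> \<open>A shared pair lies in \<open>T \<inter> T'\<close>, which has at most two
      elements and hence equals it.\<close>
    have one: "nsets T 2 \<inter> nsets T' 2 \<subseteq> {T \<inter> T'}"
    proof
      fix d assume d: "d \<in> nsets T 2 \<inter> nsets T' 2"
      have "card (T \<inter> T') < card T"
      proof (rule psubset_card_mono)
        have "T \<inter> T' \<noteq> T"
        proof
          assume "T \<inter> T' = T"
          then have "T \<subseteq> T'" by blast
          then have "T = T'" by (rule card_subset_eq[OF TT(9)]) (simp only: TT)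
          then show False using T'I(2) by blast
        qed
        then show "T \<inter> T' \<subset> T" by auto
      qed (use TT in auto)
      then have "card (T \<inter> T') \<le> card d" using TT d by (auto simp: nsets_def)
      then have "d = T \<inter> T'"
        using d TT by (intro card_seteq) (auto simp: nsets_def)
      then show "d \<in> {T \<inter> T'}" by simp
    qed
    have "card ?D + card (nsets T 2 \<inter> nsets T' 2) = 6"
      using TT card_Un_Int[of "nsets T 2" "nsets T' 2"] by simp
    moreover have "card (nsets T 2 \<inter> nsets T' 2) \<le> 1"
      using card_mono[OF _ one] by simp
    ultimately have D5: "card ?D \<ge> 5" by linarith
    have "A T \<inter> A T' \<subseteq> {\<kappa>. \<exists>c\<in>R T. \<forall>d\<in>?D. \<kappa> d = c}"
    proof
      fix \<kappa> assume "\<kappa> \<in> A T \<inter> A T'"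
      then obtain c c' where c: "c \<in> R T" "\<And>d. d \<in> nsets T 2 \<Longrightarrow> \<kappa> d = c"
        "\<And>d. d \<in> nsets T' 2 \<Longrightarrow> \<kappa> d = c'"
        unfolding A_def by blast
      obtain d where "d \<in> nsets T 2" "d \<in> nsets T' 2" using T'I(3) by blast
      then have "c' = c" using c(2,3) by metis
      then show "\<kappa> \<in> {\<kappa>. \<exists>c\<in>R T. \<forall>d\<in>?D. \<kappa> d = c}" using c by blast
    qed
    then have "measure_pmf.prob M (A T \<inter> A T') \<le> measure_pmf.prob M {\<kappa>. \<exists>c\<in>R T. \<forall>d\<in>?D. \<kappa> d = c}"
      by (intro measure_pmf.finite_measure_mono) auto
    also have "\<dots> = card (R T) / k ^ card ?D"
      unfolding M_def using TT by (intro prob_Pi_pmf_constant_on[OF finE _ _ R]) auto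
    also have "\<dots> \<le> card (R T) / k ^ 5"
    proof -
      have "real k ^ 5 \<le> real k ^ card ?D" using D5 k by (intro power_increasing) auto
      then show ?thesis using k by (simp add: frac_le)
    qed
    also have "\<dots> = measure_pmf.prob M (A T) / k ^ 2"
      by (simp add: pA[OF TI] numeral_eq_Suc mult_ac)
    finally show ?thesis .
  qed
  \<comment> \<open>A neighbor of \<open>T\<close> is obtained by exchanging one of its three
    vertices for a vertex of \<open>S\<close>.\<close>
  have nb_card: "card (nb T) \<le> 3 * card S" and nb_fin: "finite (nb T)" if TI: "T \<in> I" for T
  proof -
    have "nb T \<subseteq> (\<lambda>(x, v). insert v (T - {x})) ` (T \<times> S)"
    proof
      fix T' assume T': "T' \<in> nb T"
      then obtain d where d: "d \<in> nsets T 2" "d \<in> nsets T' 2" and T'I: "T' \<in> I" by (auto simp: nb_def)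
      have d': "d \<subseteq> T" "d \<subseteq> T'" "card d = 2" "finite d" using d by (auto simp: nsets_def)
      have "card (T - d) = 1" "card (T' - d) = 1"
        using d' T[OF TI] T[OF T'I] by (auto simp: card_Diff_subset)
      then obtain x v where xv: "T - d = {x}" "T' - d = {v}" by (auto simp: card_1_singleton_iff)
      then have "T' = insert v (T - {x})" "x \<in> T" "v \<in> S" using d' T[OF T'I] by auto
      then show "T' \<in> (\<lambda>(x, v). insert v (T - {x})) ` (T \<times> S)" by force
    qed
    moreover have f: "finite (T \<times> S)" using T[OF TI] finS by simp
    ultimately have "card (nb T) \<le> card (T \<times> S)" "finite (nb T)"
      by (auto intro: surj_card_le finite_surj)
    then show "card (nb T) \<le> 3 * card S" "finite (nb T)"
      using T[OF TI] by (auto simp: card_cartesian_product)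
  qed
  \<comment> \<open>The summand 1 accounts for \<open>T\<close> itself. Since \<open>S\<close> is
    nonempty, the left side is at most \<open>4 * card S\<close>, and
    \<open>32 = 4 * 8\<close>.\<close>
  have S3: "real (3 * card S) + 1 \<le> real k ^ 2 / 8" if "T \<in> I" for T
  proof -
    have "3 \<le> card S" using card_mono[OF finS T(1)[OF that]] T(3)[OF that] by simp
    moreover have "real (32 * card S) \<le> real (k ^ 2)" using S by (simp only: of_nat_le_iff)
    ultimately show ?thesis by simp
  qed
  have nb_k: "(1 + real (card (nb T))) / k ^ 2 \<le> 1/8" if "T \<in> I" for T
  proof -
    have "1 + real (card (nb T)) \<le> real k ^ 2 / 8" using S3[OF that] nb_card[OF that] by linarith
    then show ?thesis using k by (simp add: divide_simps)
  qed
  have "measure_pmf.prob M (measure_pmf.avoid M A I) \<le> exp (- (\<Sum>T\<in>I. measure_pmf.prob M (A T)) / 2)"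
  proof (rule measure_pmf.prob_avoid_le_exp[where nb = nb])
    show "finite I" by fact
    show "nb T \<subseteq> I" for T by (auto simp: nb_def)
    show "measure_pmf.prob M (A T \<inter> measure_pmf.avoid M A J)
        = measure_pmf.prob M (A T) * measure_pmf.prob M (measure_pmf.avoid M A J)"
      if "T \<in> I" "J \<subseteq> I - insert T (nb T)" for T J
    proof (rule indep[of "nsets T 2"])
      show "nsets T 2 \<subseteq> nsets V 2" using T(4) that(1) .
      show "J \<subseteq> I" using that(2) by blast
      show "nsets U 2 \<inter> nsets T 2 = {}" if "U \<in> J" for U
        using that \<open>J \<subseteq> I - insert T (nb T)\<close> by (auto simp: nb_def)
    qed (rule A_cong)
    show "measure_pmf.prob M (A T \<inter> A T' \<inter> measure_pmf.avoid M A J)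
        = measure_pmf.prob M (A T \<inter> A T') * measure_pmf.prob M (measure_pmf.avoid M A J)"
      if TT: "T \<in> I" "T' \<in> nb T" "J \<subseteq> I - (insert T (nb T) \<union> insert T' (nb T'))" for T T' J
    proof (rule indep[of "nsets T 2 \<union> nsets T' 2"])
      show "nsets T 2 \<union> nsets T' 2 \<subseteq> nsets V 2"
        using TT T(4)[of T] T(4)[of T'] by (auto simp: nb_def)
      show "nsets U 2 \<inter> (nsets T 2 \<union> nsets T' 2) = {}" if "U \<in> J" for U
        using TT that by (auto simp: nb_def)
      show "\<kappa> \<in> A T \<inter> A T' \<longleftrightarrow> \<kappa>' \<in> A T \<inter> A T'"
        if "\<And>d. d \<in> nsets T 2 \<union> nsets T' 2 \<Longrightarrow> \<kappa> d = \<kappa>' d" for \<kappa> \<kappa>'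
        using that A_cong[of T \<kappa> \<kappa>'] A_cong[of T' \<kappa> \<kappa>'] by auto
    qed (use TT in auto)
    show "measure_pmf.prob M (A T) + (\<Sum>T'\<in>nb T. measure_pmf.prob M (A T')) \<le> 1/8" if "T \<in> I" for T
    proof -
      have "(\<Sum>T'\<in>nb T. measure_pmf.prob M (A T')) \<le> (\<Sum>T'\<in>nb T. 1 / k ^ 2)"
        by (intro sum_mono pA_le) (auto simp: nb_def)
      also have "\<dots> = card (nb T) / k ^ 2" by simp
      finally show ?thesis
        using pA_le[OF that] nb_k[OF that] unfolding add_divide_distrib by linarith
    qed
    show "(\<Sum>T'\<in>nb T. measure_pmf.prob M (A T \<inter> A T')) \<le> measure_pmf.prob M (A T) / 4" if "T \<in> I" for T
    proof -
      have "(\<Sum>T'\<in>nb T. measure_pmf.prob M (A T \<inter> A T')) \<le> (\<Sum>T'\<in>nb T. measure_pmf.prob M (A T) / k ^ 2)"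
        by (intro sum_mono pAA that)
      also have "\<dots> = measure_pmf.prob M (A T) * (card (nb T) / k ^ 2)" by simp
      also have "\<dots> \<le> measure_pmf.prob M (A T) * (1/4)"
      proof (rule mult_left_mono)
        have "real (card (nb T)) / k ^ 2 \<le> (1 + real (card (nb T))) / k ^ 2" by (intro divide_right_mono) auto
        then show "real (card (nb T)) / k ^ 2 \<le> 1/4" using nb_k[OF that] by linarith
      qed simp
      finally show ?thesis by simp
    qed
  qed auto
  also have "\<dots> \<le> exp (- (real (card S choose 3) / (2 * m * k ^ 2)))"
  proof -
    have "real (card S choose 3) / (m * k ^ 2) = (\<Sum>T\<in>I. 1 / (m * k ^ 2))"
      using finS by (simp add: I_def card_nsets)
    also have "\<dots> \<le> (\<Sum>T\<in>I. measure_pmf.prob M (A T))"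
    proof (rule sum_mono)
      fix T assume TI: "T \<in> I"
      then have "real k / m \<le> card (R T)" using Rk[of T] m by (simp add: I_def field_simps)
      then have "real k / m / k ^ 3 \<le> card (R T) / k ^ 3" by (intro divide_right_mono) auto
      moreover have "real k / m / k ^ 3 = 1 / (m * k ^ 2)"
        using k by (simp add: power2_eq_square power3_eq_cube)
      ultimately show "1 / (m * k ^ 2) \<le> measure_pmf.prob M (A T)" by (simp add: pA[OF TI])
    qed
    finally show ?thesis by simp
  qed
  finally show ?thesis unfolding avoid by (simp add: A_def I_def M_def)
qed

section \<open>The union bound over all vertex sets of size \<open>n\<close>\<close>

text \<open>There are at most \<open>card V ^ n\<close> sets of size \<open>n\<close>;
  \<open>large\<close> says that this count is outweighed by the bound for a single set with
  \<open>m = 108\<close>, whence \<open>216 = 2 * 108\<close>. So some pair coloring leaves no such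
  set without a red triple.\<close>

lemma ex_coloring_tripartite_small_blue:
  fixes V :: "'a set" and k n :: nat
  assumes V: "finite V" and k: "324 * ln (card V) < real k" and n: "32 * n \<le> k ^ 2" "n > 0"
    and large: "real n * ln (card V) < real (n choose 3) / (216 * real k ^ 2)"
  shows "\<exists>col :: 'a set \<Rightarrow> color.
    (\<forall>W E. subgraph W E V (nsets V 3) \<and> tightly_connected E \<and> (\<forall>e\<in>E. col e = Red) \<longrightarrow> tripartite W E) \<and>
    (\<forall>S. S \<subseteq> V \<and> (\<forall>e\<in>nsets S 3. col e = Blue) \<longrightarrow> card S < n)"
proof -
  obtain f :: "nat \<Rightarrow> 'a \<Rightarrow> nat" where f: "\<And>c v. f c v < 3"
    and fk: "\<And>T. T \<in> nsets V 3 \<Longrightarrow> real k \<le> 108 * card {c. c < k \<and> inj_on (f c) T}"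
    using ex_3colorings_injective_on_triples[OF V k] by blast
  define R where "R T = {c. c < k \<and> inj_on (f c) T}" for T
  define M where "M = Pi_pmf (nsets V 2) 0 (\<lambda>_. pmf_of_set {..<k})"
  define B where "B S = {\<kappa>. \<forall>T\<in>nsets S 3. \<not> (\<exists>c\<in>R T. \<forall>d\<in>nsets T 2. \<kappa> d = c)}" for S
  have k0: "k > 0" using n by (cases "k = 0") auto
  have finV: "finite (nsets V n)" using V by (rule finite_imp_finite_nsets)
  have "measure_pmf.prob M (\<Union>S\<in>nsets V n. B S) < 1"
  proof (cases "n \<le> card V")
    case False
    then have "nsets V n = {}" using V by (intro nsets_eq_empty) auto
    then show ?thesis by simp
  next
    case True
    have "measure_pmf.prob M (\<Union>S\<in>nsets V n. B S) \<le> (\<Sum>S\<in>nsets V n. measure_pmf.prob M (B S))"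
      using finV by (intro measure_pmf.finite_measure_subadditive_finite) auto
    also have "\<dots> \<le> (\<Sum>S\<in>nsets V n. exp (- (real (n choose 3) / (216 * k ^ 2))))"
    proof (rule sum_mono)
      fix S assume "S \<in> nsets V n"
      then have S: "S \<subseteq> V" "card S = n" by (auto simp: nsets_def)
      have "real k \<le> 108 * card (R T)" if "T \<in> nsets S 3" for T
        unfolding R_def using that nsets_mono[OF S(1)] by (intro fk) auto
      then show "measure_pmf.prob M (B S) \<le> exp (- (real (n choose 3) / (216 * k ^ 2)))"
        using prob_no_red_triple_le[OF V S(1), of R k 108] S n k0 by (auto simp: R_def B_def M_def)
    qed
    also have "\<dots> = real (card (nsets V n)) * exp (- (real (n choose 3) / (216 * k ^ 2)))" by simp
    also have "\<dots> \<le> exp (n * ln (card V)) * exp (- (real (n choose 3) / (216 * k ^ 2)))"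
    proof (rule mult_right_mono)
      have "real (card (nsets V n)) \<le> real (card V ^ n)"
        using True V by (simp only: card_nsets of_nat_le_iff binomial_le_pow)
      also have "\<dots> = exp (n * ln (card V))"
        using True n by (simp add: exp_of_nat_mult)
      finally show "real (card (nsets V n)) \<le> exp (n * ln (card V))" .
    qed simp
    also have "\<dots> < 1" using large by (simp flip: exp_add)
    finally show ?thesis .
  qed
  then have "(\<Union>S\<in>nsets V n. B S) \<noteq> UNIV" by (metis measure_pmf_UNIV less_irrefl)
  then obtain \<kappa> where \<kappa>: "\<And>S. S \<in> nsets V n \<Longrightarrow> \<kappa> \<notin> B S" by blast
  define col where "col e = (if \<exists>c\<in>R e. \<forall>d\<in>nsets e 2. \<kappa> d = c then Red else Blue)" for e
  have "tripartite W E" if "subgraph W E V (nsets V 3)" "tightly_connected E" "\<forall>e\<in>E. col e = Red" for W E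
  proof (rule tightly_connected_mono_tripartite[of W E f \<kappa>])
    show "three_graph W E" using that by (simp add: subgraph_def)
    show "\<exists>c. inj_on (f c) e \<and> (\<forall>d\<in>nsets e 2. \<kappa> d = c)" if "e \<in> E" for e
      using \<open>\<forall>e\<in>E. col e = Red\<close> that by (force simp: col_def R_def split: if_splits)
  qed (use that f in auto)
  moreover have "card S < n" if S: "S \<subseteq> V" "\<forall>e\<in>nsets S 3. col e = Blue" for S
  proof (rule ccontr)
    assume "\<not> card S < n"
    \<comment> \<open>The union bound covers only sets of size exactly \<open>n\<close>; blueness
      passes to subsets.\<close>
    then obtain S' where S': "S' \<subseteq> S" "card S' = n" "finite S'"
      using obtain_subset_with_card_n[of n S] by auto
    then have "S' \<in> nsets V n" using S by (auto simp: nsets_def)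
    moreover have "\<kappa> \<in> B S'"
      unfolding B_def
    proof (intro CollectI ballI notI)
      fix T assume T: "T \<in> nsets S' 3" and c: "\<exists>c\<in>R T. \<forall>d\<in>nsets T 2. \<kappa> d = c"
      then have "col T = Blue" using S nsets_mono[OF S'(1)] by blast
      then show False using c by (simp add: col_def)
    qed
    ultimately show False using \<kappa> by blast
  qed
  ultimately show ?thesis by blast
qed

section \<open>Choice of the parameters\<close>

theorem theorem2p1:
  "\<exists>C::real. C > 0 \<and>
     (\<forall>N::nat. N \<ge> 2 \<longrightarrow>
        (\<exists>col :: nat set \<Rightarrow> color.
           (\<forall>V E. subgraph V E {1..N} (nsets {1..N} 3) \<and> tightly_connected E
                  \<and> (\<forall>e\<in>E. col e = Red) \<longrightarrow> tripartite V E) \<and>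
           (\<forall>S. S \<subseteq> {1..N} \<and> (\<forall>e \<in> nsets S 3. col e = Blue) \<longrightarrow>
                real (card S) \<le> C * ln (real N) powr (3 / 2))))"
proof (intro exI[of _ "40001 + 4 * exp (81::real)"] conjI allI impI)
  show "(0::real) < 40001 + 4 * exp 81" by (simp add: add_pos_pos)
next
  fix N :: nat assume N: "N \<ge> 2"
  define L where "L = ln (real N)"
  have L2: "L \<ge> 1/2"
  proof -
    have "ln 2 \<le> L" using N by (simp add: L_def)
    moreover have "(1::real)/2 \<le> ln 2" using ln2_ge_two_thirds by simp
    ultimately show ?thesis by linarith
  qed
  let ?P = "\<lambda>col. (\<forall>V E. subgraph V E {1..N} (nsets {1..N} 3) \<and> tightly_connected E
                  \<and> (\<forall>e\<in>E. col e = Red) \<longrightarrow> tripartite V E)"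
  show "\<exists>col. ?P col \<and> (\<forall>S. S \<subseteq> {1..N} \<and> (\<forall>e \<in> nsets S 3. col e = Blue) \<longrightarrow>
                real (card S) \<le> (40001 + 4 * exp 81) * ln (real N) powr (3 / 2))"
  \<comment> \<open>For \<open>L < 81\<close> the all-blue coloring works:
    \<open>N < exp 81\<close>, and \<open>L powr (3/2) \<ge> 1/4\<close> explains the summand
    \<open>4 * exp 81\<close> of the constant. The summand 40001 serves the large case.\<close>
  proof (cases "L \<ge> 81")
    case False
    have "(1/2) powr 2 \<le> (1/2 :: real) powr (3/2)" by (intro powr_mono') auto
    also have "\<dots> \<le> L powr (3/2)" using L2 by (intro powr_mono2) auto
    finally have L4: "L powr (3/2) \<ge> 1/4" by (simp add: power2_eq_square)
    have "real N = exp L" using N by (simp add: L_def)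
    also have "\<dots> \<le> exp 81" using False by simp
    also have "exp 81 \<le> (40001 + 4 * exp 81) * (1/4 :: real)" by simp
    also have "\<dots> \<le> (40001 + 4 * exp 81) * L powr (3/2)"
      using L4 by (intro mult_left_mono) (auto intro!: add_nonneg_nonneg)
    finally have *: "real N \<le> (40001 + 4 * exp 81) * L powr (3/2)" .
    have "real (card S) \<le> (40001 + 4 * exp 81) * L powr (3/2)" if "S \<subseteq> {1..N}" for S
      using card_mono[OF _ that] * by simp
    moreover have "?P (\<lambda>_. Blue)"
    proof (intro allI impI)
      fix V and E :: "nat set set"
      assume "subgraph V E {1..N} (nsets {1..N} 3) \<and> tightly_connected E \<and> (\<forall>e\<in>E. Blue = Red)"
      then have "E = {}" by auto
      then show "tripartite V E"
        unfolding tripartite_def by (intro exI[of _ V] exI[of _ "{}"]) auto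
    qed
    ultimately show ?thesis unfolding L_def[symmetric] by (intro exI[of _ "\<lambda>_. Blue"]) blast
  next
    case True
    \<comment> \<open>With \<open>s\<close> in place of \<open>L\<close>, all exponents become
      integers.\<close>
    define s where "s = sqrt L"
    have s: "s \<ge> 9" "s ^ 2 = L"
      using True real_le_rsqrt[of 9 L] by (auto simp: s_def)
    have "L powr (3/2) = (s powr 2) powr (3/2)" using s by (simp flip: s(2))
    also have "\<dots> = s powr 3" by (subst powr_powr) simp
    also have "\<dots> = s ^ 3" using s by simp
    finally have Ls: "L powr (3/2) = s ^ 3" .
    have s3: "s ^ 3 \<ge> 1" "s ^ 2 \<ge> 1" using one_le_power[of s 3] one_le_power[of s 2] s(1) by linarith+
    \<comment> \<open>Rounding up adds at most 1, which \<open>s^2 \<ge> 1\<close> and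
      \<open>s^3 \<ge> 1\<close> absorb into the factors 401 and 40001.\<close>
    define k n where "k = nat \<lceil>400 * s ^ 2\<rceil>" and "n = nat \<lceil>40000 * s ^ 3\<rceil>"
    have k: "400 * s ^ 2 \<le> k" "k \<le> 401 * s ^ 2"
      using s3 unfolding k_def by linarith+
    have n: "40000 * s ^ 3 \<le> n" "n \<le> 40001 * s ^ 3"
      using s3 unfolding n_def by linarith+
    have n3: "n \<ge> 3" using n s3 by linarith
    have k0: "k > 0" using k s3 by (cases "k = 0") auto
    have "\<exists>col. ?P col \<and> (\<forall>S. S \<subseteq> {1..N} \<and> (\<forall>e\<in>nsets S 3. col e = Blue) \<longrightarrow> card S < n)"
    proof (rule ex_coloring_tripartite_small_blue)
      show "324 * ln (card {1..N}) < real k" using k(1) s3 by (simp flip: L_def add: s(2)[symmetric])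
      \<comment> \<open>Here \<open>n\<close> has order \<open>s^3\<close> and \<open>k^2\<close>
        order \<open>s^4\<close>; the threshold \<open>s \<ge> 9\<close> makes up for the
        constants.\<close>
      have "32 * real n \<le> 32 * 40001 * s ^ 3" using n by simp
      also have "\<dots> \<le> 160000 * (9 * s ^ 3)" using s by simp
      also have "\<dots> \<le> 160000 * (s * s ^ 3)" using s by (intro mult_left_mono mult_right_mono) auto
      also have "\<dots> = (400 * s ^ 2) ^ 2" by (simp add: power2_eq_square power3_eq_cube)
      also have "\<dots> \<le> real k ^ 2" using k by (intro power_mono) auto
      finally have "real (32 * n) \<le> real (k ^ 2)" by simp
      then show "32 * n \<le> k ^ 2" by (simp only: of_nat_le_iff)
      \<comment> \<open>\<open>5832 = 216 * 27\<close>, where 27 comes from bounding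
        \<open>n choose 3\<close> below by \<open>(n / 3)^3\<close>. The claim reduces to
        \<open>5832 * k^2 * s^2 < n^2\<close>, with both sides of order \<open>s^6\<close>.\<close>
      have "5832 * real k ^ 2 * s ^ 2 \<le> 5832 * (401 * s ^ 2) ^ 2 * s ^ 2"
        using k by (intro mult_left_mono mult_right_mono power_mono) auto
      also have "\<dots> = 937791432 * s ^ 6" by (simp add: power_numeral_reduce algebra_simps)
      also have "\<dots> < 1600000000 * s ^ 6" using s(1) by simp
      also have "\<dots> = (40000 * s ^ 3) ^ 2" by (simp add: power_numeral_reduce algebra_simps)
      also have "\<dots> \<le> real n ^ 2" using n s by (intro power_mono) auto
      finally have "real n * (5832 * real k ^ 2 * s ^ 2) < real n * real n ^ 2"
        using n3 by (intro mult_strict_left_mono) auto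
      then have "real n * s ^ 2 < (real n / 3) ^ 3 / (216 * real k ^ 2)"
        using k0 by (simp add: field_simps power2_eq_square power3_eq_cube)
      also have "\<dots> \<le> real (n choose 3) / (216 * real k ^ 2)"
        using binomial_ge_n_over_k_pow_k[of 3 n, where 'a = real] n3 by (intro divide_right_mono) auto
      finally show "real n * ln (card {1..N}) < real (n choose 3) / (216 * real k ^ 2)"
        by (simp add: s(2) flip: L_def)
    qed (use n3 in auto)
    then obtain col where col: "?P col"
      "\<And>S. S \<subseteq> {1..N} \<Longrightarrow> (\<forall>e\<in>nsets S 3. col e = Blue) \<Longrightarrow> card S < n" by blast
    have "real (card S) \<le> (40001 + 4 * exp 81) * s ^ 3"
      if "S \<subseteq> {1..N}" "\<forall>e\<in>nsets S 3. col e = Blue" for S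
    proof -
      have "real (card S) \<le> 40001 * s ^ 3" using col(2)[OF that] n(2) by simp
      also have "\<dots> \<le> (40001 + 4 * exp 81) * s ^ 3" using s by (intro mult_right_mono) auto
      finally show ?thesis .
    qed
    then show ?thesis using col(1) Ls unfolding L_def[symmetric] by (intro exI[of _ col]) auto
  qed
qed

end
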